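(* Let $n$ range over the even positive integers. As $n\to\infty$, the expected values of the cycle length and of the tail length as seen from a uniformly random node in a uniformly random binary functional graph of size $n$ satisfy: (i) the expected (average) cycle length is asymptotic to $\sqrt{\pi n/8}$; (ii) the expected (average) tail length is asymptotic to $\sqrt{\pi n/8}$.
   Context: A functional graph of size $n$ is the directed graph on the labeled vertex set $\{1,\dots,n\}$ associated with a map $f:\{1,\dots,n\}\to\{1,\dots,n\}$, having an edge $\langle a,b\rangle$ if and only if $f(a)=b$. It is a binary functional graph if each node has in-degree exactly $0$ or $2$ (such graphs exist only for even $n$). A random binary functional graph of size $n$ is chosen uniformly from all binary functional graphs on $\{1,\dots,n\}$, and the random node is chosen uniformly from $\{1,\dots,n\}$ independently of the graph. For a node $u_0$, put $u_{k+1}=f(u_k)$. The tail length seen from $u_0$ is the number of iterations (edges) from $u_0$ to the first cyclic node in this sequence (it is $0$ if $u_0$ is cyclic), and the cycle length seen from $u_0$ is the number of nodes on the cycle the sequence eventually enters. Here $a_n$ is asymptotic to $b_n$ means $a_n/b_n\to 1$ as $n\to\infty$. *)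

theory Defs
  imports
    "HOL-Probability.Probability"
    "HOL-Combinatorics.Orbits"
    "HOL-Library.Landau_Symbols"
    "Graph_Theory.Digraph"
begin

definition functional_graph :: "nat \<Rightarrow> (nat \<Rightarrow> nat) \<Rightarrow> (nat, nat \<times> nat) pre_digraph" where
  "functional_graph n f =
     \<lparr>verts = {1..n}, arcs = {(a, b). a \<in> {1..n} \<and> b \<in> {1..n} \<and> f a = b}, tail = fst, head = snd\<rparr>"

text \<open>
  Binary functional graphs are represented by their maps. Since the maps are extensional on
  \<open>{1..n}\<close>, distinct maps have distinct graphs, so a uniform choice of the map is a
  uniform choice of the graph. The set is nonempty iff \<open>n\<close> is even.
\<close>

definition binary_functional_maps :: "nat \<Rightarrow> (nat \<Rightarrow> nat) set" where
  "binary_functional_maps n =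
     {f \<in> {1..n} \<rightarrow>\<^sub>E {1..n}.
        \<forall>v \<in> verts (functional_graph n f). in_degree (functional_graph n f) v \<in> {0, 2}}"

text \<open>
  \<open>orbit f v\<close> consists of the iterates of \<open>v\<close> under one or more applications of \<open>f\<close>, so
  \<open>v \<in> orbit f v\<close> says that \<open>v\<close> lies on a cycle, and then \<open>orbit f v\<close> is that cycle.
\<close>

definition cyclic_node :: "(nat \<Rightarrow> nat) \<Rightarrow> nat \<Rightarrow> bool" where
  "cyclic_node f v \<longleftrightarrow> v \<in> orbit f v"

definition tail_length :: "(nat \<Rightarrow> nat) \<Rightarrow> nat \<Rightarrow> nat" where
  "tail_length f u = (LEAST k. cyclic_node f ((f ^^ k) u))"

definition cycle_length :: "(nat \<Rightarrow> nat) \<Rightarrow> nat \<Rightarrow> nat" where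
  "cycle_length f u = card (orbit f ((f ^^ tail_length f u) u))"

definition random_map_and_node :: "nat \<Rightarrow> ((nat \<Rightarrow> nat) \<times> nat) pmf" where
  "random_map_and_node n = pair_pmf (pmf_of_set (binary_functional_maps n)) (pmf_of_set {1..n})"

definition expected_cycle_length :: "nat \<Rightarrow> real" where
  "expected_cycle_length n =
     measure_pmf.expectation (random_map_and_node n) (\<lambda>(f, u). real (cycle_length f u))"

definition expected_tail_length :: "nat \<Rightarrow> real" where
  "expected_tail_length n =
     measure_pmf.expectation (random_map_and_node n) (\<lambda>(f, u). real (tail_length f u))"

text \<open>The filter of \<open>n\<close> tending to infinity through the even numbers.\<close>

definition even_at_top :: "nat filter" where
  "even_at_top = inf at_top (principal {n. even n})"

end

(*
  Given a node u, the nodes met before the first repetition form a list of t + c distinct nodes, where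
  t is the tail length and c the cycle length, and the last of them is mapped back to entry t. For
  n = 2m the number of binary maps compatible with a given such list depends only on t + c (with a
  shift by one if t = 0), so the number of pairs (f, u) with given t and c is (2m)! / 2^m times
  w k = 2^k * binomial (2m - k) m, where k = t + c - 1 for t > 0 and k = c for t = 0.
  The weights satisfy (2m - k) w (k+1) = 2 (m - k) w k, which evaluates the sums of (k+1) w k and of
  k (k+1) w k exactly. With B = 4^m / binomial (2m) m this gives the expected tail length
  ((m+1) B - (2m+1)) / (2m), and the expected cycle length exceeds it by (2m + 1 - B) / (2m), which
  is bounded. Wallis' product gives B ~ sqrt (pi m).
*)

theory Submission
  imports Defs "HOL-Real_Asymp.Real_Asymp"
begin

subsection \<open>Counting maps with fibres of size 0 or 2\<close>

text \<open>The offset \<open>c v\<close> counts preimages of \<open>v\<close> already fixed outside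
  \<open>A\<close>. It keeps the class closed under removing points from the domain while
  \<open>V\<close> stays the same.\<close>

definition binary_maps :: "'a set \<Rightarrow> 'b set \<Rightarrow> ('b \<Rightarrow> nat) \<Rightarrow> ('a \<Rightarrow> 'b) set" where
  "binary_maps A V c = {g \<in> A \<rightarrow>\<^sub>E V. \<forall>v\<in>V. card {x \<in> A. g x = v} + c v \<in> {0, 2}}"

lemma finite_binary_maps: "finite A \<Longrightarrow> finite V \<Longrightarrow> finite (binary_maps A V c)"
  unfolding binary_maps_def by (rule finite_subset[OF _ finite_PiE]) auto

text \<open>Restriction to \<open>A\<close> and extension by \<open>h\<close> are mutually inverse;
  the preimages lying in \<open>X\<close> move into the offset.\<close>

lemma card_binary_maps_extending:
  assumes fin: "finite A" "finite X" and disj: "A \<inter> X = {}" and h: "\<And>x. x \<in> X \<Longrightarrow> h x \<in> V"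
  shows "card {f \<in> binary_maps (A \<union> X) V c. \<forall>x\<in>X. f x = h x} =
         card (binary_maps A V (\<lambda>v. card {x \<in> X. h x = v} + c v))"
proof (rule bij_betw_same_card, rule bij_betw_byWitness[where f = "\<lambda>f. restrict f A"
      and f' = "\<lambda>g x. if x \<in> X then h x else g x"])
  let ?ext = "\<lambda>g x. if x \<in> X then h x else g x"
  have split: "card {x \<in> A \<union> X. f x = v} = card {x \<in> A. g x = v} + card {x \<in> X. h x = v}"
    if "\<forall>x\<in>X. f x = h x" "\<forall>x\<in>A. f x = g x" for f g v
  proof -
    have "{x \<in> A \<union> X. f x = v} = {x \<in> A. g x = v} \<union> {x \<in> X. h x = v}"
      using that by auto
    then show ?thesis
      using fin disj by (simp add: card_Un_disjoint disjoint_iff)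
  qed
  show "\<forall>f\<in>{f \<in> binary_maps (A \<union> X) V c. \<forall>x\<in>X. f x = h x}. ?ext (restrict f A) = f"
    by (auto simp: binary_maps_def fun_eq_iff PiE_def extensional_def)
  show "\<forall>g\<in>binary_maps A V (\<lambda>v. card {x \<in> X. h x = v} + c v). restrict (?ext g) A = g"
    using disj by (auto simp: binary_maps_def fun_eq_iff PiE_def extensional_def)
  show "(\<lambda>f. restrict f A) ` {f \<in> binary_maps (A \<union> X) V c. \<forall>x\<in>X. f x = h x}
        \<subseteq> binary_maps A V (\<lambda>v. card {x \<in> X. h x = v} + c v)"
  proof clarify
    fix f assume f: "f \<in> binary_maps (A \<union> X) V c" "\<forall>x\<in>X. f x = h x"
    have "card {x \<in> A \<union> X. f x = v} = card {x \<in> A. restrict f A x = v} + card {x \<in> X. h x = v}" for v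
      by (rule split) (use f in auto)
    then show "restrict f A \<in> binary_maps A V (\<lambda>v. card {x \<in> X. h x = v} + c v)"
      using f(1) by (simp add: binary_maps_def add.assoc) auto
  qed
  show "?ext ` binary_maps A V (\<lambda>v. card {x \<in> X. h x = v} + c v)
        \<subseteq> {f \<in> binary_maps (A \<union> X) V c. \<forall>x\<in>X. f x = h x}"
  proof clarify
    fix g assume g: "g \<in> binary_maps A V (\<lambda>v. card {x \<in> X. h x = v} + c v)"
    have "card {x \<in> A \<union> X. ?ext g x = v} = card {x \<in> A. g x = v} + card {x \<in> X. h x = v}" for v
      by (rule split) (use disj in auto)
    then show "?ext g \<in> binary_maps (A \<union> X) V c \<and> (\<forall>x\<in>X. ?ext g x = h x)"
      using g h by (auto simp: binary_maps_def add.assoc PiE_def extensional_def)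
  qed
qed

lemma card_binary_maps_insert:
  assumes "finite A" "finite V" "x \<notin> A"
  shows "card (binary_maps (insert x A) V c) = (\<Sum>v\<in>V. card (binary_maps A V (c(v := Suc (c v)))))"
proof -
  have "binary_maps (insert x A) V c = (\<Union>v\<in>V. {f \<in> binary_maps (insert x A) V c. f x = v})"
    by (auto simp: binary_maps_def)
  then have "card (binary_maps (insert x A) V c) =
      card (\<Union>v\<in>V. {f \<in> binary_maps (insert x A) V c. f x = v})"
    by simp
  also have "\<dots> = (\<Sum>v\<in>V. card {f \<in> binary_maps (insert x A) V c. f x = v})"
    using assms by (intro card_UN_disjoint) (auto simp: finite_binary_maps)
  also have "\<dots> = (\<Sum>v\<in>V. card (binary_maps A V (c(v := Suc (c v)))))"
  proof (rule sum.cong[OF refl])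
    fix v assume "v \<in> V"
    then have "card {f \<in> binary_maps (insert x A) V c. f x = v} =
        card (binary_maps A V (\<lambda>w. card {y \<in> {x}. v = w} + c w))"
      using card_binary_maps_extending[of A "{x}" "\<lambda>_. v" V c] assms by simp
    also have "(\<lambda>w. card {y \<in> {x}. v = w} + c w) = c(v := Suc (c v))"
      by (auto simp: fun_eq_iff)
    finally show "card {f \<in> binary_maps (insert x A) V c. f x = v} =
        card (binary_maps A V (c(v := Suc (c v))))" .
  qed
  finally show ?thesis .
qed

text \<open>Each value with offset 1 still needs a preimage in \<open>A\<close>, and different
  values need different preimages.\<close>

lemma binary_maps_empty_if_too_small:
  assumes "finite A" "finite V" "card A < card {v \<in> V. c v = 1}"
  shows "binary_maps A V c = {}"
proof (rule ccontr)
  assume "binary_maps A V c \<noteq> {}"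
  then obtain g where g: "\<forall>v\<in>V. card {x \<in> A. g x = v} + c v \<in> {0, 2}"
    by (auto simp: binary_maps_def)
  have "{v \<in> V. c v = 1} \<subseteq> g ` A"
  proof clarify
    fix v assume "v \<in> V" "c v = 1"
    then have "card {x \<in> A. g x = v} = 1"
      using g by fastforce
    then have "{x \<in> A. g x = v} \<noteq> {}"
      by (metis card.empty zero_neq_one)
    then show "v \<in> g ` A" by auto
  qed
  then have "card {v \<in> V. c v = 1} \<le> card A"
    using assms(1) by (meson card_image_le card_mono finite_imageI le_trans)
  with assms(3) show False by simp
qed

text \<open>Exactly \<open>s\<close> of the values with offset 0 receive two preimages from
  \<open>A\<close>. Once they are chosen, the points of \<open>A\<close> can be distributed in
  \<open>fact (card A) / 2 ^ s\<close> ways. The factor \<open>2 ^ s\<close> stands on the left to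
  stay within the natural numbers.\<close>

lemma card_binary_maps:
  fixes A :: "'a set" and V :: "'b set"
  assumes "finite A" "finite V" "\<forall>v\<in>V. c v \<le> 2"
    and "card A = card {v \<in> V. c v = 1} + 2 * s"
  shows "card (binary_maps A V c) * 2 ^ s = fact (card A) * (card {v \<in> V. c v = 0} choose s)"
  using assms(1,3,4)
proof (induction A arbitrary: c s rule: finite_induct)
  case empty
  then have "s = 0" "{v \<in> V. c v = 1} = {}"
    using \<open>finite V\<close> by auto
  then have "\<forall>v\<in>V. c v = 0 \<or> c v = 2"
    using empty by (auto simp: numeral_2_eq_2 le_Suc_eq)
  then have "(binary_maps {} V c :: ('a \<Rightarrow> 'b) set) = {\<lambda>_. undefined}"
    by (auto simp: binary_maps_def)
  with \<open>s = 0\<close> show ?case by simp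
next
  case (insert x A)
  let ?P = "{v \<in> V. c v = 1}" and ?Q = "{v \<in> V. c v = 0}"
  let ?a = "card A" and ?p = "card {v \<in> V. c v = 1}" and ?q = "card {v \<in> V. c v = 0}"
  let ?N = "\<lambda>v. card (binary_maps A V (c(v := Suc (c v))))"
  have fin: "finite ?P" "finite ?Q" using \<open>finite V\<close> by auto
  have card: "Suc ?a = ?p + 2 * s" using insert by simp
  \<comment> \<open>Sending \<open>x\<close> to a value with offset 1 completes that value and
    leaves \<open>s\<close> unchanged.\<close>
  have P: "?N v * 2 ^ s = fact ?a * (?q choose s)" if "v \<in> ?P" for v
  proof -
    let ?c = "c(v := Suc (c v))"
    have eqs: "{w \<in> V. ?c w = 1} = ?P - {v}" "{w \<in> V. ?c w = 0} = ?Q"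
      using that by auto
    have "card (?P - {v}) = ?p - 1" "?p > 0"
      using that fin card_gt_0_iff by auto
    then have "?a = card {w \<in> V. ?c w = 1} + 2 * s"
      unfolding eqs using card by linarith
    moreover have "\<forall>w\<in>V. ?c w \<le> 2"
      using insert.prems(1) that by simp
    ultimately have "?N v * 2 ^ s = fact ?a * (card {w \<in> V. ?c w = 0} choose s)"
      by (intro insert.IH)
    then show ?thesis unfolding eqs .
  qed
  \<comment> \<open>Sending \<open>x\<close> to a free value moves it from \<open>?Q\<close> to
    \<open>?P\<close> and lowers \<open>s\<close> by one. For \<open>s = 0\<close> there are then
    more open demands than points left in \<open>A\<close>.\<close>
  have Q: "?N v * 2 ^ s = fact ?a * (if s = 0 then 0 else 2 * ((?q - 1) choose (s - 1)))"
    if "v \<in> ?Q" for v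
  proof -
    let ?c = "c(v := Suc (c v))"
    have eqs: "{w \<in> V. ?c w = 1} = insert v ?P" "{w \<in> V. ?c w = 0} = ?Q - {v}"
      using that by auto
    have p: "card {w \<in> V. ?c w = 1} = Suc ?p" "card {w \<in> V. ?c w = 0} = ?q - 1"
      unfolding eqs using that fin by auto
    show ?thesis
    proof (cases s)
      case 0
      then have "binary_maps A V ?c = {}"
        using card p insert.hyps \<open>finite V\<close> by (intro binary_maps_empty_if_too_small) auto
      then show ?thesis using 0 by simp
    next
      case (Suc t)
      then have "?a = card {w \<in> V. ?c w = 1} + 2 * t"
        unfolding p using card by linarith
      moreover have "\<forall>w\<in>V. ?c w \<le> 2"
        using insert.prems(1) that by simp
      ultimately have "?N v * 2 ^ t = fact ?a * (card {w \<in> V. ?c w = 0} choose t)"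
        by (intro insert.IH)
      then have "?N v * 2 ^ t = fact ?a * ((?q - 1) choose t)"
        unfolding p(2) .
      then show ?thesis using Suc by simp
    qed
  qed
  have zero: "?N v = 0" if "v \<in> V" "v \<notin> ?P \<union> ?Q" for v
  proof -
    have "c v = 2" using that insert.prems(1) by (auto simp: numeral_2_eq_2 le_Suc_eq)
    then have "binary_maps A V (c(v := Suc (c v))) = {}"
      using that(1) by (auto simp: binary_maps_def)
    then show ?thesis by simp
  qed
  have "card (binary_maps (insert x A) V c) * 2 ^ s = (\<Sum>v\<in>V. ?N v * 2 ^ s)"
    by (simp only: card_binary_maps_insert[OF insert.hyps(1) \<open>finite V\<close> insert.hyps(2)] sum_distrib_right)
  also have "\<dots> = (\<Sum>v\<in>?P \<union> ?Q. ?N v * 2 ^ s)"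
    using \<open>finite V\<close> zero by (intro sum.mono_neutral_right) auto
  also have "\<dots> = (\<Sum>v\<in>?P. ?N v * 2 ^ s) + (\<Sum>v\<in>?Q. ?N v * 2 ^ s)"
    using fin by (intro sum.union_disjoint) auto
  also have "\<dots> = fact ?a * (?p * (?q choose s) + ?q * (if s = 0 then 0 else 2 * ((?q - 1) choose (s - 1))))"
    using P Q by (simp add: algebra_simps)
  \<comment> \<open>By absorption both cases become multiples of the same binomial coefficient, with
    coefficients adding up to \<open>?p + 2 * s = Suc ?a\<close>.\<close>
  also have "?q * (if s = 0 then 0 else 2 * ((?q - 1) choose (s - 1))) = 2 * s * (?q choose s)"
    using times_binomial_minus1_eq[of s ?q] by simp
  also have "fact ?a * (?p * (?q choose s) + 2 * s * (?q choose s)) = fact (Suc ?a) * (?q choose s)"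
    unfolding distrib_right[symmetric] card[symmetric] by (simp add: algebra_simps)
  finally show ?case using insert.hyps by simp
qed

lemma binary_functional_maps_eq: "binary_functional_maps n = binary_maps {1..n} {1..n} (\<lambda>_. 0)"
proof -
  have "in_degree (functional_graph n f) v = card {x \<in> {1..n}. f x = v}" if "v \<in> {1..n}" for f v
  proof -
    have "in_arcs (functional_graph n f) v = (\<lambda>x. (x, v)) ` {x \<in> {1..n}. f x = v}"
      using that by (auto simp: in_arcs_def functional_graph_def)
    then show ?thesis
      by (simp add: in_degree_def card_image inj_on_def)
  qed
  then show ?thesis
    by (auto simp: binary_functional_maps_def binary_maps_def functional_graph_def)
qed

subsection \<open>Tail and cycle\<close>

text \<open>Expresses tail \<open>t\<close> and cycle \<open>c\<close> through finitely many
  iterates, a form that can be counted. With \<open>c = 0\<close> the closing equation would be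
  trivial.\<close>

definition rho_shape :: "('a \<Rightarrow> 'a) \<Rightarrow> 'a \<Rightarrow> nat \<Rightarrow> nat \<Rightarrow> bool" where
  "rho_shape f u t c \<longleftrightarrow>
     c > 0 \<and> inj_on (\<lambda>i. (f ^^ i) u) {..<t + c} \<and> (f ^^ (t + c)) u = (f ^^ t) u"

lemma rho_shape_orbit:
  assumes "rho_shape f u t c"
  shows "orbit f ((f ^^ t) u) = (\<lambda>i. (f ^^ i) u) ` {t..<t + c}"
proof -
  have "(f ^^ c) ((f ^^ t) u) = (f ^^ t) u"
    using assms by (simp add: rho_shape_def add.commute flip: funpow_add o_apply[of "f ^^ c"])
  then have "orbit f ((f ^^ t) u) = {(f ^^ m) ((f ^^ t) u) | m. m < c}"
    using assms by (intro orbit_altdef_bounded) (auto simp: rho_shape_def)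
  also have "\<dots> = (\<lambda>m. (f ^^ (m + t)) u) ` {0..<c}"
    by (auto simp: funpow_add)
  also have "\<dots> = (\<lambda>i. (f ^^ i) u) ` (\<lambda>m. m + t) ` {0..<c}"
    by (simp only: image_image)
  finally show ?thesis by (simp only: image_add_atLeastLessThan' add_0 add.commute[of c])
qed

text \<open>If iterate \<open>j < t\<close> were cyclic, iterate \<open>t\<close> would lie on its
  cycle, so iterate \<open>j\<close> would in turn lie in the orbit of iterate \<open>t\<close>. It
  would then equal an iterate of index at least \<open>t\<close>, against injectivity.\<close>

lemma rho_shape_imp:
  assumes rho: "rho_shape f u t c"
  shows "tail_length f u = t" "cycle_length f u = c"
proof -
  have inj: "inj_on (\<lambda>i. (f ^^ i) u) {..<t + c}" and "c > 0"
    using rho by (auto simp: rho_shape_def)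
  have "cyclic_node f ((f ^^ t) u)"
    unfolding cyclic_node_def rho_shape_orbit[OF rho] using \<open>c > 0\<close> by auto
  moreover have "\<not> cyclic_node f ((f ^^ j) u)" if "j < t" for j
  proof
    assume "cyclic_node f ((f ^^ j) u)"
    then have j: "(f ^^ j) u \<in> orbit f ((f ^^ j) u)"
      by (simp add: cyclic_node_def)
    have "(f ^^ t) u = (f ^^ (t - j)) ((f ^^ j) u)"
      using that by (metis add.commute add_diff_inverse_nat funpow_add less_imp_not_less o_apply)
    also have "\<dots> \<in> orbit f ((f ^^ j) u)"
      using j by (rule funpow_in_orbit)
    finally have "(f ^^ j) u \<in> orbit f ((f ^^ t) u)"
      by (rule orbit_swap[OF j])
    then obtain i where i: "i \<in> {t..<t + c}" "(f ^^ j) u = (f ^^ i) u"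
      unfolding rho_shape_orbit[OF rho] by blast
    then have "j = i"
      using that by (intro inj_onD[OF inj i(2)]) auto
    with i(1) that show False by simp
  qed
  ultimately show tail: "tail_length f u = t"
    unfolding tail_length_def by (intro Least_equality) (auto simp: not_less[symmetric])
  have "inj_on (\<lambda>i. (f ^^ i) u) {t..<t + c}"
    using inj by (rule inj_on_subset) auto
  then show "cycle_length f u = c"
    by (simp add: cycle_length_def tail rho_shape_orbit[OF rho] card_image)
qed

lemma funpow_in_set: "f \<in> V \<rightarrow> V \<Longrightarrow> u \<in> V \<Longrightarrow> (f ^^ i) u \<in> V"
  by (induction i) auto

lemma rho_shape_le_card:
  assumes "finite V" "f \<in> V \<rightarrow> V" "u \<in> V" "rho_shape f u t c"
  shows "t + c \<le> card V"
proof -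
  have "t + c = card ((\<lambda>i. (f ^^ i) u) ` {..<t + c})"
    using assms(4) by (simp add: rho_shape_def card_image)
  also have "\<dots> \<le> card V"
    using assms funpow_in_set[OF assms(2,3)] by (intro card_mono) auto
  finally show ?thesis .
qed

text \<open>By the pigeonhole principle there is a first iterate \<open>n\<close> that repeats an
  earlier one; the index of that earlier one is \<open>t\<close>, and
  \<open>c = n - t\<close>.\<close>

lemma rho_shape_exists:
  assumes "finite V" "f \<in> V \<rightarrow> V" "u \<in> V"
  shows "\<exists>t c. rho_shape f u t c"
proof -
  let ?s = "\<lambda>i. (f ^^ i) u"
  have "\<not> inj_on ?s {..<Suc (card V)}"
  proof
    assume "inj_on ?s {..<Suc (card V)}"
    moreover have "?s ` {..<Suc (card V)} \<subseteq> V"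
      using funpow_in_set[OF assms(2,3)] by auto
    ultimately show False
      using card_inj_on_le[of ?s "{..<Suc (card V)}" V] assms(1) by simp
  qed
  then obtain n where n: "\<not> inj_on ?s {..<Suc n}" "\<forall>k<n. inj_on ?s {..<Suc k}"
    using exists_least_iff[of "\<lambda>n. \<not> inj_on ?s {..<Suc n}"] by blast
  have inj: "inj_on ?s {..<n}"
    using n(2) by (cases n) auto
  with n(1) obtain t where t: "t < n" "?s n = ?s t"
    by (auto simp: lessThan_Suc)
  then have "rho_shape f u t (n - t)"
    using inj by (simp add: rho_shape_def)
  then show ?thesis by blast
qed

lemma rho_shape_tail_cycle:
  assumes "finite V" "f \<in> V \<rightarrow> V" "u \<in> V"
  shows "rho_shape f u t c \<longleftrightarrow> tail_length f u = t \<and> cycle_length f u = c"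
  using rho_shape_imp rho_shape_exists[OF assms] by metis

subsection \<open>Counting maps with a given tail and cycle\<close>

text \<open>When \<open>V\<close> has \<open>2 * m\<close> elements, \<open>k\<close> is the number
  of values that already have a preimage, and \<open>s = m - k\<close> in the general count.
  Choosing \<open>m\<close> instead of \<open>m - k\<close> by symmetry gives a formula that also
  vanishes correctly for \<open>k > m\<close>.\<close>

lemma card_binary_maps_deficit:
  assumes fin: "finite A" "finite V" and c: "\<forall>v\<in>V. c v \<le> 2"
    and card: "card A + 2 * k = card {v \<in> V. c v = 1} + 2 * m"
    and free: "card {v \<in> V. c v = 0} + k = 2 * m"
  shows "card (binary_maps A V c) * 2 ^ m = fact (card A) * 2 ^ k * ((2 * m - k) choose m)"
proof (cases "k \<le> m")
  case True
  have "card (binary_maps A V c) * 2 ^ (m - k) = fact (card A) * (card {v \<in> V. c v = 0} choose (m - k))"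
    using True card by (intro card_binary_maps[OF fin c]) linarith
  also have "card {v \<in> V. c v = 0} = 2 * m - k"
    using free by linarith
  also have "(2 * m - k) choose (m - k) = (2 * m - k) choose m"
    using True binomial_symmetric[of "m - k" "2 * m - k"] by (simp add: algebra_simps)
  finally have "card (binary_maps A V c) * 2 ^ (m - k) * 2 ^ k =
      fact (card A) * ((2 * m - k) choose m) * 2 ^ k"
    by simp
  then show ?thesis
    using True by (simp add: mult.assoc mult.commute mult.left_commute flip: power_add)
next
  case False
  then have "binary_maps A V c = {}"
    using card by (intro binary_maps_empty_if_too_small fin) linarith
  moreover have "2 * m - k < m"
    using False free by linarith
  ultimately show ?thesis by simp
qed

lemma card_preimage_distinct:
  "distinct xs \<Longrightarrow> card {x \<in> set xs. h x = v} = count_list (map h xs) v"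
proof (induction xs)
  case (Cons a xs)
  have "{x \<in> set (a # xs). h x = v} = (if h a = v then insert a {x \<in> set xs. h x = v} else {x \<in> set xs. h x = v})"
    by auto
  with Cons show ?case by auto
qed simp

lemma count_list_distinct: "distinct xs \<Longrightarrow> count_list xs v = of_bool (v \<in> set xs)"
  by (induction xs) auto

lemma map_distinct_surj:
  assumes "distinct xs" "length ys = length xs"
  obtains h where "map h xs = ys"
proof
  show "map (\<lambda>x. the (map_of (zip xs ys) x)) xs = ys"
    using assms by (intro nth_equalityI) (simp_all add: map_of_zip_nth)
qed

text \<open>
  The tail and cycle of a node are its successive iterates \<open>xs\<close>, and the last of them is mapped to
  entry \<open>t\<close>. If \<open>t > 0\<close> this entry has both its preimages in \<open>xs\<close>, whereas the first entry has none.
\<close>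

lemma card_binary_maps_along:
  assumes V: "finite V" "card V = 2 * m"
    and xs: "distinct xs" "set xs \<subseteq> V" "t < length xs"
  defines "k \<equiv> if t = 0 then length xs else length xs - 1"
  shows "card {f \<in> binary_maps V V (\<lambda>_. 0). map f xs = tl xs @ [xs ! t]} * 2 ^ m =
         fact (2 * m - length xs) * 2 ^ k * ((2 * m - k) choose m)"
proof -
  let ?X = "set xs" and ?A = "V - set xs"
  obtain h where h: "map h xs = tl xs @ [xs ! t]"
    by (rule map_distinct_surj[OF xs(1), of "tl xs @ [xs ! t]"]) (use xs(3) in auto)
  have hV: "h x \<in> V" if "x \<in> ?X" for x
  proof -
    have "h x \<in> set (map h xs)" using that by simp
    also have "\<dots> \<subseteq> set xs"
      unfolding h using xs(3) by (auto dest: list.set_sel(2)[rotated])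
    finally show ?thesis using xs(2) by auto
  qed
  define c where "c v = card {x \<in> ?X. h x = v}" for v
  \<comment> \<open>The list of prescribed values is \<open>tl xs\<close> with \<open>xs ! t\<close>
    appended, and \<open>tl xs\<close> has no repetitions.\<close>
  have c: "c v = of_bool (v \<in> set (tl xs)) + of_bool (v = xs ! t)" for v
    using xs(1) by (auto simp: c_def card_preimage_distinct h count_list_distinct distinct_tl)
  have nonempty: "xs \<noteq> []" and finX: "finite ?X" using xs(3) by auto
  have lenX: "card ?X = length xs" "length xs \<le> 2 * m"
    using card_mono[OF V(1) xs(2)] xs(1) V(2) by (simp_all add: distinct_card)
  have cardA: "card ?A = 2 * m - length xs"
    using V xs lenX by (simp add: card_Diff_subset)
  have AX: "?A \<union> ?X = V" using xs by auto
  have "{f \<in> binary_maps V V (\<lambda>_. 0). map f xs = tl xs @ [xs ! t]} =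
        {f \<in> binary_maps (?A \<union> ?X) V (\<lambda>_. 0). \<forall>x\<in>?X. f x = h x}"
    unfolding AX h[symmetric] by auto
  then have "card {f \<in> binary_maps V V (\<lambda>_. 0). map f xs = tl xs @ [xs ! t]} =
        card (binary_maps ?A V c)"
    using card_binary_maps_extending[of ?A ?X h V "\<lambda>_. 0", OF _ _ _ hV] V
    by (simp add: c_def[abs_def] Int_Diff Diff_Int_distrib2)
  moreover have "card (binary_maps ?A V c) * 2 ^ m = fact (card ?A) * 2 ^ k * ((2 * m - k) choose m)"
  proof (cases "t = 0")
    case True
    \<comment> \<open>The list closes up to a cycle, so each of its entries has exactly one preimage
      so far.\<close>
    have "set xs = insert (xs ! t) (set (tl xs))" "xs ! t \<notin> set (tl xs)"
      using nonempty xs(1) True by (cases xs; simp)+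
    then have "{v \<in> V. c v = 1} = ?X" "{v \<in> V. c v = 0} = ?A"
      using xs(2) by (auto simp: c)
    then show ?thesis
      using True V lenX cardA
      by (intro card_binary_maps_deficit) (auto simp: k_def c)
  next
    case False
    have tl: "set (tl xs) \<subseteq> V" "xs ! t \<in> set (tl xs)" "card (set (tl xs)) = length xs - 1"
      using nonempty xs False by (cases xs; auto simp: nth_Cons' distinct_card)+
    \<comment> \<open>The head of \<open>xs\<close> is still free and \<open>xs ! t\<close> is
      saturated; the other \<open>length xs - 2\<close> entries each lack one preimage. Hence the
      shift by one in \<open>k\<close>.\<close>
    have "{v \<in> V. c v = 1} = set (tl xs) - {xs ! t}" "{v \<in> V. c v = 0} = V - set (tl xs)"
      using tl by (auto simp: c)
    then have "card {v \<in> V. c v = 1} = length xs - 2" "card {v \<in> V. c v = 0} = 2 * m - (length xs - 1)"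
      using tl V by (simp_all add: card_Diff_subset)
    then show ?thesis
      using False V lenX cardA xs(3)
      by (intro card_binary_maps_deficit) (auto simp: k_def c)
  qed
  ultimately show ?thesis using cardA by simp
qed

text \<open>Reading the list equation entrywise gives \<open>f (xs ! i) = xs ! Suc i\<close>, and
  the last entry returns to \<open>xs ! t\<close>. This allows the list to be chosen first and the
  maps compatible with it to be counted afterwards.\<close>

lemma map_eq_shift_iff:
  assumes "t < length xs"
  shows "map f xs = tl xs @ [xs ! t] \<longleftrightarrow>
    xs = map (\<lambda>i. (f ^^ i) (hd xs)) [0..<length xs] \<and>
    (f ^^ length xs) (hd xs) = (f ^^ t) (hd xs)"
    (is "?L \<longleftrightarrow> ?R")
proof
  assume L: ?L
  have step: "f (xs ! i) = (if Suc i < length xs then xs ! Suc i else xs ! t)" if "i < length xs" for i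
    using arg_cong[OF L, of "\<lambda>ys. ys ! i"] that
    by (auto simp: nth_append nth_tl less_diff_conv not_less le_diff_conv split: if_splits)
  have iter: "xs ! i = (f ^^ i) (hd xs)" if "i < length xs" for i
    using that
  proof (induction i)
    case 0 then show ?case by (simp add: hd_conv_nth)
  next
    case (Suc i)
    then show ?case using step[of i] by simp
  qed
  have "(f ^^ length xs) (hd xs) = f (xs ! (length xs - 1))"
    using assms iter[of "length xs - 1"] by (cases "length xs") auto
  also have "\<dots> = xs ! t"
  proof -
    have "Suc (length xs - 1) = length xs" using assms by simp
    then show ?thesis using step[of "length xs - 1"] by simp
  qed
  finally show ?R
    using iter assms by (auto intro!: nth_equalityI)
next
  assume R: ?R
  have iter: "xs ! i = (f ^^ i) (hd xs)" if "i < length xs" for i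
    using arg_cong[OF conjunct1[OF R], of "\<lambda>ys. ys ! i"] that by simp
  show ?L
  proof (rule nth_equalityI)
    show "length (map f xs) = length (tl xs @ [xs ! t])" using assms by simp
    fix i assume "i < length (map f xs)"
    then have i: "i < length xs" by simp
    show "map f xs ! i = (tl xs @ [xs ! t]) ! i"
    proof (cases "Suc i < length xs")
      case True
      then show ?thesis using iter[of i] iter[of "Suc i"]
        by (auto simp: nth_append nth_tl less_diff_conv)
    next
      case False
      then have "Suc i = length xs" using i by simp
      moreover from this have "f ((f ^^ i) (hd xs)) = (f ^^ t) (hd xs)"
        using conjunct2[OF R] by (metis funpow.simps(2) o_apply)
      ultimately show ?thesis using i iter[OF i] iter[OF assms]
        by (auto simp: nth_append)
    qed
  qed
qed

text \<open>Replacing \<open>u\<close> by its first \<open>t + c\<close> iterates gives a bijection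
  with pairs of a distinct list and a map following it. The number of maps is the same for every
  list, and the number of lists is the falling factorial
  \<open>fact (2 * m) / fact (2 * m - (t + c))\<close>.\<close>

lemma card_rho_shape:
  fixes V :: "'a set"
  assumes V: "finite V" "card V = 2 * m" and tc: "c > 0" "t + c \<le> 2 * m"
  defines "k \<equiv> if t = 0 then c else t + c - 1"
  shows "card {(f, u) \<in> binary_maps V V (\<lambda>_. 0) \<times> V. rho_shape f u t c} * 2 ^ m =
         fact (2 * m) * 2 ^ k * ((2 * m - k) choose m)"
proof -
  let ?M = "binary_maps V V (\<lambda>_. 0)" and ?L = "t + c"
  let ?Xs = "{xs :: 'a list. length xs = ?L \<and> distinct xs \<and> set xs \<subseteq> V}"
  let ?F = "\<lambda>xs. {f \<in> ?M. map f xs = tl xs @ [xs ! t]}"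
  have "bij_betw (\<lambda>(f, u). (map (\<lambda>i. (f ^^ i) u) [0..<?L], f))
      {(f, u) \<in> ?M \<times> V. rho_shape f u t c} (Sigma ?Xs ?F)"
  proof (rule bij_betw_byWitness[where f' = "\<lambda>(xs, f). (f, hd xs)"])
    have hd: "hd (map (\<lambda>i. (f ^^ i) u) [0..<?L]) = u" for f and u :: 'a
      using tc by (simp add: hd_map)
    show "\<forall>p\<in>{(f, u) \<in> ?M \<times> V. rho_shape f u t c}.
        (case (case p of (f, u) \<Rightarrow> (map (\<lambda>i. (f ^^ i) u) [0..<?L], f)) of (xs, f) \<Rightarrow> (f, hd xs)) = p"
      using hd by auto
    show "\<forall>q\<in>Sigma ?Xs ?F.
        (case (case q of (xs, f) \<Rightarrow> (f, hd xs)) of (f, u) \<Rightarrow> (map (\<lambda>i. (f ^^ i) u) [0..<?L], f)) = q"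
    proof -
      have "map (\<lambda>i. (f ^^ i) (hd xs)) [0..<?L] = xs"
        if "length xs = ?L" "map f xs = tl xs @ [xs ! t]" for xs :: "'a list" and f
        using map_eq_shift_iff[of t xs f] that tc by simp
      then show ?thesis by auto
    qed
    show "(\<lambda>(f, u). (map (\<lambda>i. (f ^^ i) u) [0..<?L], f)) ` {(f, u) \<in> ?M \<times> V. rho_shape f u t c}
        \<subseteq> Sigma ?Xs ?F"
    proof clarify
      fix f u assume f: "f \<in> ?M" and u: "u \<in> V" and rho: "rho_shape f u t c"
      let ?xs = "map (\<lambda>i. (f ^^ i) u) [0..<?L]"
      have "f \<in> V \<rightarrow> V" using f by (auto simp: binary_maps_def)
      then have "set ?xs \<subseteq> V" using u funpow_in_set by auto
      moreover have "distinct ?xs"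
        using rho by (simp add: rho_shape_def distinct_map lessThan_atLeast0)
      moreover have "map f ?xs = tl ?xs @ [?xs ! t]"
        using rho tc hd[of f u] by (subst map_eq_shift_iff) (auto simp: rho_shape_def)
      ultimately show "?xs \<in> ?Xs \<and> f \<in> ?F ?xs"
        using f by simp
    qed
    show "(\<lambda>(xs, f). (f, hd xs)) ` Sigma ?Xs ?F \<subseteq> {(f, u) \<in> ?M \<times> V. rho_shape f u t c}"
    proof -
      have "hd xs \<in> V \<and> rho_shape f (hd xs) t c"
        if xs: "length xs = ?L" "distinct xs" "set xs \<subseteq> V"
          and f: "map f xs = tl xs @ [xs ! t]" for xs f
      proof -
      have *: "xs = map (\<lambda>i. (f ^^ i) (hd xs)) [0..<?L]" "(f ^^ ?L) (hd xs) = (f ^^ t) (hd xs)"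
        using f map_eq_shift_iff[of t xs f] xs(1) tc by simp_all
      have "inj_on (\<lambda>i. (f ^^ i) (hd xs)) {..<?L}"
        using xs(2) by (subst (asm) *(1)) (simp add: distinct_map lessThan_atLeast0)
      moreover have "hd xs \<in> V"
        using xs tc hd_in_set[of xs] by (cases xs) auto
      ultimately show ?thesis
        using * tc by (simp add: rho_shape_def)
      qed
      then show ?thesis by auto
    qed
  qed
  then have "card {(f, u) \<in> ?M \<times> V. rho_shape f u t c} = card (Sigma ?Xs ?F)"
    by (rule bij_betw_same_card)
  also have "\<dots> = (\<Sum>xs\<in>?Xs. card (?F xs))"
    using V by (intro card_SigmaI) (auto simp: finite_binary_maps intro: finite_subset[OF _ finite_lists_length_eq[OF V(1), of ?L]])
  finally have "card {(f, u) \<in> ?M \<times> V. rho_shape f u t c} * 2 ^ m = (\<Sum>xs\<in>?Xs. card (?F xs) * 2 ^ m)"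
    by (simp add: sum_distrib_right)
  also have "\<dots> = (\<Sum>xs\<in>?Xs. fact (2 * m - ?L) * 2 ^ k * ((2 * m - k) choose m))"
  proof (rule sum.cong[OF refl])
    fix xs assume "xs \<in> ?Xs"
    then show "card (?F xs) * 2 ^ m = fact (2 * m - ?L) * 2 ^ k * ((2 * m - k) choose m)"
      using card_binary_maps_along[OF V, of xs t] tc by (cases "t = 0") (simp_all add: k_def)
  qed
  also have "\<dots> = (\<Prod>{2 * m - ?L + 1..2 * m} * fact (2 * m - ?L)) * 2 ^ k * ((2 * m - k) choose m)"
    using card_lists_distinct_length_eq[OF V(1), of ?L] V tc by simp
  \<comment> \<open>The falling factorial counting the lists absorbs the factorial from the maps, so
    the list length survives only through \<open>k\<close>.\<close>
  also have "\<Prod>{2 * m - ?L + 1..2 * m} * fact (2 * m - ?L) = fact (2 * m)"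
    using fact_div_fact[of "2 * m - ?L" "2 * m"] fact_dvd[of "2 * m - ?L" "2 * m"]
    by (metis Suc_eq_plus1 diff_le_self dvd_div_mult_self)
  finally show ?thesis .
qed

subsection \<open>Expected values\<close>

definition rho_weight :: "nat \<Rightarrow> nat \<Rightarrow> real" where
  "rho_weight m k = real (2 ^ k * ((2 * m - k) choose m))"

lemma rho_weight_0: "rho_weight m 0 = real ((2 * m) choose m)"
  by (simp add: rho_weight_def)

lemma rho_weight_eq_0: "m > 0 \<Longrightarrow> k > m \<Longrightarrow> rho_weight m k = 0"
  by (simp add: rho_weight_def)

text \<open>This is the absorption identity
  \<open>(n - m) * (n choose m) = n * ((n - 1) choose m)\<close> at
  \<open>n = 2 * m - k\<close>.\<close>

lemma rho_weight_rec:
  assumes "m > 0" "k \<le> m"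
  shows "(2 * real m - real k) * rho_weight m (Suc k) = 2 * (real m - real k) * rho_weight m k"
proof -
  have "(2 * m - k) * ((2 * m - Suc k) choose m) = (m - k) * ((2 * m - k) choose m)"
    using binomial_absorb_comp[of "2 * m - k" m] assms by simp
  then have "real (2 * m - k) * real ((2 * m - Suc k) choose m) =
      real (m - k) * real ((2 * m - k) choose m)"
    by (metis of_nat_mult)
  then have rec: "(2 * real m - real k) * real ((2 * m - Suc k) choose m) =
      (real m - real k) * real ((2 * m - k) choose m)"
    using assms by (simp add: of_nat_diff)
  have "(2 * real m - real k) * rho_weight m (Suc k) =
      2 * 2 ^ k * ((2 * real m - real k) * real ((2 * m - Suc k) choose m))"
    by (simp add: rho_weight_def)
  also have "\<dots> = 2 * (real m - real k) * rho_weight m k"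
    unfolding rec by (simp add: rho_weight_def)
  finally show ?thesis .
qed

text \<open>With \<open>k = m - j\<close> the sum becomes \<open>2 ^ m\<close> times the sum over
  \<open>j \<le> m\<close> of \<open>((m + j) choose j) / 2 ^ j\<close>, whose value is known to be
  \<open>2 ^ m\<close>.\<close>

lemma sum_rho_weight: "(\<Sum>k\<le>m. rho_weight m k) = 4 ^ m"
proof -
  have "(\<Sum>k\<le>m. rho_weight m k) = (\<Sum>j\<le>m. rho_weight m (m - j))"
    by (rule sum.reindex_bij_witness[of _ "\<lambda>j. m - j" "\<lambda>j. m - j"]) auto
  also have "\<dots> = (\<Sum>j\<le>m. 2 ^ m * ((of_nat (m + j) gchoose j) / 2 ^ j))"
  proof (rule sum.cong[OF refl])
    fix j assume "j \<in> {..m}"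
    then have j: "j \<le> m" "2 * m - (m - j) = m + j" by auto
    have "(m + j) choose m = (m + j) choose j"
      using binomial_symmetric[of m "m + j"] by simp
    moreover have "(2 :: real) ^ (m - j) = 2 ^ m / 2 ^ j"
      using j by (simp add: power_diff)
    ultimately show "rho_weight m (m - j) = 2 ^ m * ((of_nat (m + j) gchoose j) / 2 ^ j)"
      using j by (simp add: rho_weight_def binomial_gbinomial)
  qed
  also have "\<dots> = 2 ^ m * 2 ^ m"
    unfolding sum_distrib_left[symmetric] gbinomial_sum_nat_pow2 ..
  also have "\<dots> = 4 ^ m"
    by (simp flip: power_mult_distrib)
  finally show ?thesis .
qed

text \<open>
  Multiplying the recurrence by \<open>1\<close> and by \<open>k\<close> turns the following two sums into telescoping ones.
\<close>

lemma sum_Suc_rho_weight: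
  assumes "m > 0"
  shows "(\<Sum>k\<le>m. (real k + 1) * rho_weight m k) = (2 * real m + 1) * rho_weight m 0"
proof -
  \<comment> \<open>By the recurrence, the summand is the increment of
    \<open>- (2 * m + 1 - n) * rho_weight m n\<close>; at \<open>n = Suc m\<close> the boundary term
    vanishes.\<close>
  have "(\<Sum>k<n. (real k + 1) * rho_weight m k) =
      (2 * real m + 1) * rho_weight m 0 - (2 * real m + 1 - real n) * rho_weight m n"
    if "n \<le> Suc m" for n
    using that
  proof (induction n)
    case (Suc n)
    then show ?case
      using rho_weight_rec[OF assms, of n] by (simp add: algebra_simps)
  qed simp
  from this[of "Suc m"] show ?thesis
    using rho_weight_eq_0[of m "Suc m"] assms by (simp add: lessThan_Suc_atMost)
qed

lemma sum_mult_Suc_rho_weight: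
  assumes "m > 0"
  shows "(\<Sum>k\<le>m. real k * (real k + 1) * rho_weight m k) =
         2 * (real m + 1) * 4 ^ m - 2 * (2 * real m + 1) * rho_weight m 0"
proof -
  \<comment> \<open>The quadratic is what the recurrence multiplied by \<open>n\<close> yields as
    the increment of \<open>- (n - 1) * (2 * m + 1 - n) * rho_weight m n\<close>.\<close>
  have "(\<Sum>k<n. ((real k)\<^sup>2 + 2 * real k - 2 * real m - 1) * rho_weight m k) =
      - (2 * real m + 1) * rho_weight m 0 - (real n - 1) * (2 * real m + 1 - real n) * rho_weight m n"
    if "n \<le> Suc m" for n
    using that
  proof (induction n)
    case (Suc n)
    have "real n * ((2 * real m - real n) * rho_weight m (Suc n)) =
        real n * (2 * (real m - real n) * rho_weight m n)"
      using rho_weight_rec[OF assms, of n] Suc.prems by simp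
    then show ?case
      using Suc by (simp add: algebra_simps power2_eq_square)
  qed simp
  from this[of "Suc m"]
  have "(\<Sum>k\<le>m. ((real k)\<^sup>2 + 2 * real k - 2 * real m - 1) * rho_weight m k) =
      - (2 * real m + 1) * rho_weight m 0"
    using rho_weight_eq_0[of m "Suc m"] assms by (simp add: lessThan_Suc_atMost)
  \<comment> \<open>\<open>k * (k + 1)\<close> is split into the telescoping quadratic, the constant
    \<open>2 * (m + 1)\<close> and \<open>- (k + 1)\<close>, whose weighted sums are all
    known.\<close>
  moreover have "(\<Sum>k\<le>m. real k * (real k + 1) * rho_weight m k) =
      (\<Sum>k\<le>m. ((real k)\<^sup>2 + 2 * real k - 2 * real m - 1) * rho_weight m k
        + 2 * (real m + 1) * rho_weight m k - (real k + 1) * rho_weight m k)"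
    by (intro sum.cong refl) (simp add: algebra_simps power2_eq_square)
  moreover have "\<dots> = (\<Sum>k\<le>m. ((real k)\<^sup>2 + 2 * real k - 2 * real m - 1) * rho_weight m k)
      + 2 * (real m + 1) * 4 ^ m - (2 * real m + 1) * rho_weight m 0"
    by (simp only: sum.distrib sum_subtractf sum_distrib_left[symmetric] sum_rho_weight
        sum_Suc_rho_weight[OF assms])
  ultimately show ?thesis
    by (simp add: algebra_simps)
qed

section \<open>Expectations as weighted sums\<close>

lemma card_binary_functional_maps:
  "card (binary_functional_maps (2 * m)) * 2 ^ m = fact (2 * m) * ((2 * m) choose m)"
proof -
  have "{v \<in> {1..2 * m}. (0 :: nat) = 0} = {1..2 * m}" by auto
  then show ?thesis
    using card_binary_maps[of "{1..2 * m}" "{1..2 * m}" "\<lambda>_. 0" m]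
    by (simp add: binary_functional_maps_eq)
qed

lemma finite_binary_functional_maps: "finite (binary_functional_maps n)"
  unfolding binary_functional_maps_eq by (simp add: finite_binary_maps)

lemma binary_functional_maps_nonempty: "binary_functional_maps (2 * m) \<noteq> {}"
proof
  assume "binary_functional_maps (2 * m) = {}"
  with card_binary_functional_maps[of m] show False by simp
qed

lemma expectation_pair_pmf_of_set:
  fixes F :: "'a \<Rightarrow> 'b \<Rightarrow> real"
  assumes "finite A" "A \<noteq> {}" "finite B" "B \<noteq> {}"
  shows "measure_pmf.expectation (pair_pmf (pmf_of_set A) (pmf_of_set B)) (\<lambda>(a, b). F a b) =
         (\<Sum>(a, b)\<in>A \<times> B. F a b) / (real (card A) * real (card B))"
proof -
  have "measure_pmf.expectation (pair_pmf (pmf_of_set A) (pmf_of_set B)) (\<lambda>(a, b). F a b) =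
      (\<Sum>p\<in>A \<times> B. (case p of (a, b) \<Rightarrow> F a b) * pmf (pair_pmf (pmf_of_set A) (pmf_of_set B)) p)"
    using assms by (intro integral_measure_pmf_real) auto
  also have "\<dots> = (\<Sum>p\<in>A \<times> B. (case p of (a, b) \<Rightarrow> F a b) / (real (card A) * real (card B)))"
    using assms by (intro sum.cong refl) (auto simp: pmf_pair pmf_of_set[OF assms(2,1)] pmf_of_set[OF assms(4,3)])
  finally show ?thesis by (simp add: sum_divide_distrib)
qed

text \<open>The pairs are grouped by tail and cycle length, and the resulting triangle of indices is
  summed along its diagonals. On diagonal \<open>k\<close> all tails \<open>i > 0\<close> share the
  weight of index \<open>k\<close>, while tail 0 has index \<open>Suc k\<close>.\<close>

lemma sum_binary_functional_maps:
  fixes F :: "nat \<Rightarrow> nat \<Rightarrow> real"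
  assumes "m > 0"
  shows "(\<Sum>(f, u)\<in>binary_functional_maps (2 * m) \<times> {1..2 * m}. F (tail_length f u) (cycle_length f u)) * 2 ^ m =
    fact (2 * m) * (\<Sum>k<2 * m. F 0 (Suc k) * rho_weight m (Suc k)
      + (\<Sum>i=1..k. F i (Suc (k - i))) * rho_weight m k)"
proof -
  let ?V = "{1..2 * m}" and ?M = "binary_functional_maps (2 * m)"
  let ?S = "?M \<times> ?V" and ?T = "{(t, j). t + j < 2 * m}"
  \<comment> \<open>Cycle lengths are positive, so the subtraction loses nothing and the index pairs
    fill the triangle \<open>t + j < 2 * m\<close>.\<close>
  let ?g = "\<lambda>(f, u). (tail_length f u, cycle_length f u - 1)"
  let ?w = "\<lambda>t j. rho_weight m (if t = 0 then Suc j else t + j)"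
  have finT: "finite ?T"
    by (rule finite_subset[of _ "{..2 * m} \<times> {..2 * m}"]) auto
  have rho: "rho_shape f u t c \<longleftrightarrow> tail_length f u = t \<and> cycle_length f u = c"
    if "f \<in> ?M" "u \<in> ?V" for f u t c
    using that by (intro rho_shape_tail_cycle[of ?V]) (auto simp: binary_functional_maps_def)
  have bounds: "cycle_length f u > 0 \<and> tail_length f u + cycle_length f u \<le> 2 * m"
    if "f \<in> ?M" "u \<in> ?V" for f u
  proof -
    have shape: "rho_shape f u (tail_length f u) (cycle_length f u)"
      using rho[OF that] by simp
    then have "tail_length f u + cycle_length f u \<le> card ?V"
      using that by (intro rho_shape_le_card[of _ f u]) (auto simp: binary_functional_maps_def)
    then show ?thesis using shape by (simp add: rho_shape_def)
  qed
  have fibre: "{p \<in> ?S. ?g p = (t, j)} =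
      {(f, u) \<in> binary_maps ?V ?V (\<lambda>_. 0) \<times> ?V. rho_shape f u t (Suc j)}" for t j
  proof (rule set_eqI)
    fix p :: "(nat \<Rightarrow> nat) \<times> nat"
    obtain f u where p: "p = (f, u)" by (cases p)
    show "p \<in> {p \<in> ?S. ?g p = (t, j)} \<longleftrightarrow>
        p \<in> {(f, u) \<in> binary_maps ?V ?V (\<lambda>_. 0) \<times> ?V. rho_shape f u t (Suc j)}"
      using bounds[of f u] rho[of f u t "Suc j"] unfolding p binary_functional_maps_eq[symmetric]
      by auto
  qed
  have "?g ` ?S \<subseteq> ?T"
  proof clarify
    fix f u assume "f \<in> ?M" "u \<in> ?V"
    then show "tail_length f u + (cycle_length f u - 1) < 2 * m"
      using bounds[of f u] by linarith
  qed
  then have "(\<Sum>(f, u)\<in>?S. F (tail_length f u) (cycle_length f u)) =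
      (\<Sum>q\<in>?T. \<Sum>p\<in>{p \<in> ?S. ?g p = q}. (case p of (f, u) \<Rightarrow> F (tail_length f u) (cycle_length f u)))"
    by (intro sum.group[symmetric] finT) (simp_all add: finite_binary_functional_maps)
  also have "\<dots> = (\<Sum>(t, j)\<in>?T. F t (Suc j) * real (card {p \<in> ?S. ?g p = (t, j)}))"
  proof (rule sum.cong[OF refl], clarify)
    fix t j
    have "(\<Sum>p\<in>{p \<in> ?S. ?g p = (t, j)}. (case p of (f, u) \<Rightarrow> F (tail_length f u) (cycle_length f u))) =
        (\<Sum>p\<in>{p \<in> ?S. ?g p = (t, j)}. F t (Suc j))"
      using bounds by (intro sum.cong refl) auto
    then show "(\<Sum>p\<in>{p \<in> ?S. ?g p = (t, j)}. (case p of (f, u) \<Rightarrow> F (tail_length f u) (cycle_length f u))) =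
        F t (Suc j) * real (card {p \<in> ?S. ?g p = (t, j)})"
      by (simp add: mult.commute)
  qed
  finally have "(\<Sum>(f, u)\<in>?S. F (tail_length f u) (cycle_length f u)) * 2 ^ m =
      (\<Sum>(t, j)\<in>?T. F t (Suc j) * (real (card {p \<in> ?S. ?g p = (t, j)}) * 2 ^ m))"
    by (simp add: sum_distrib_right mult.assoc case_prod_unfold)
  also have "\<dots> = (\<Sum>(t, j)\<in>?T. fact (2 * m) * (F t (Suc j) * ?w t j))"
  proof (rule sum.cong[OF refl], clarify)
    fix t j assume "t + j < 2 * m"
    then have "card {p \<in> ?S. ?g p = (t, j)} * 2 ^ m = fact (2 * m) *
        2 ^ (if t = 0 then Suc j else t + Suc j - 1) *
        ((2 * m - (if t = 0 then Suc j else t + Suc j - 1)) choose m)"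
      unfolding fibre by (intro card_rho_shape) auto
    then have "real (card {p \<in> ?S. ?g p = (t, j)} * 2 ^ m) = fact (2 * m) * ?w t j"
      by (simp add: rho_weight_def)
    then show "F t (Suc j) * (real (card {p \<in> ?S. ?g p = (t, j)}) * 2 ^ m) =
        fact (2 * m) * (F t (Suc j) * ?w t j)"
      by simp
  qed
  also have "\<dots> = fact (2 * m) * (\<Sum>(t, j)\<in>?T. F t (Suc j) * ?w t j)"
    by (simp add: sum_distrib_left case_prod_unfold)
  also have "(\<Sum>(t, j)\<in>?T. F t (Suc j) * ?w t j) =
      (\<Sum>k<2 * m. \<Sum>i\<le>k. F i (Suc (k - i)) * ?w i (k - i))"
    by (rule sum.triangle_reindex)
  also have "\<dots> = (\<Sum>k<2 * m. F 0 (Suc k) * rho_weight m (Suc k)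
      + (\<Sum>i=1..k. F i (Suc (k - i))) * rho_weight m k)"
  proof (rule sum.cong[OF refl])
    fix k :: nat
    have "{..k} = insert 0 {1..k}" by auto
    then show "(\<Sum>i\<le>k. F i (Suc (k - i)) * ?w i (k - i)) = F 0 (Suc k) * rho_weight m (Suc k)
        + (\<Sum>i=1..k. F i (Suc (k - i))) * rho_weight m k"
      by (simp add: sum_distrib_right)
  qed
  finally show ?thesis .
qed

text \<open>Numerator and number of maps share the factor \<open>fact (2 * m) / 2 ^ m\<close>; what
  remains of the number of pairs is \<open>2 * m * rho_weight m 0\<close>.\<close>

lemma expectation_binary_functional_maps:
  fixes F :: "nat \<Rightarrow> nat \<Rightarrow> real"
  assumes "m > 0"
  shows "measure_pmf.expectation (random_map_and_node (2 * m))
      (\<lambda>(f, u). F (tail_length f u) (cycle_length f u)) =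
    (\<Sum>k<2 * m. F 0 (Suc k) * rho_weight m (Suc k)
      + (\<Sum>i=1..k. F i (Suc (k - i))) * rho_weight m k) / (2 * real m * rho_weight m 0)"
proof -
  let ?N = "real (card (binary_functional_maps (2 * m)))"
  let ?T = "\<Sum>(f, u)\<in>binary_functional_maps (2 * m) \<times> {1..2 * m}. F (tail_length f u) (cycle_length f u)"
  have N: "?N * 2 ^ m = fact (2 * m) * rho_weight m 0"
    using arg_cong[OF card_binary_functional_maps[of m], of real] by (simp add: rho_weight_0)
  have "measure_pmf.expectation (random_map_and_node (2 * m))
      (\<lambda>(f, u). F (tail_length f u) (cycle_length f u)) = ?T / (?N * (2 * real m))"
    unfolding random_map_and_node_def
    using assms finite_binary_functional_maps binary_functional_maps_nonempty
    by (subst expectation_pair_pmf_of_set) auto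
  also have "\<dots> = (?T * 2 ^ m) / (?N * 2 ^ m * (2 * real m))"
    by simp
  finally show ?thesis
    unfolding N sum_binary_functional_maps[OF assms] by (simp add: mult.commute mult.left_commute)
qed

section \<open>Closed forms of the two expectations\<close>

lemma gauss_sum_real: "(\<Sum>i=1..k. real i) = real k * (real k + 1) / 2"
  using double_gauss_sum_from_Suc_0[of k, where 'a = real] by simp

lemma sum_Suc_diff_real: "(\<Sum>i=1..k. real (Suc (k - i))) = real k * (real k + 1) / 2"
proof -
  have "(\<Sum>i=1..k. real (Suc (k - i))) = (\<Sum>i=1..k. real i)"
    by (rule sum.reindex_bij_witness[of _ "\<lambda>i. Suc k - i" "\<lambda>i. Suc k - i"]) auto
  then show ?thesis by (simp only: gauss_sum_real)
qed

lemma sum_rho_weight_extend: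
  assumes "m > 0"
  shows "(\<Sum>k<2 * m. a k * rho_weight m k) = (\<Sum>k\<le>m. a k * rho_weight m k)"
  using assms rho_weight_eq_0[OF assms] by (intro sum.mono_neutral_right) auto

text \<open>Tail 0 contributes nothing and diagonal \<open>k\<close> contributes
  \<open>k * (k + 1) / 2\<close>, so half of the sum of \<open>k * (k + 1) * rho_weight m k\<close>
  is left.\<close>

lemma expected_tail_length_even:
  assumes "m > 0"
  shows "expected_tail_length (2 * m) =
    ((real m + 1) * (4 ^ m / real ((2 * m) choose m)) - (2 * real m + 1)) / (2 * real m)"
proof -
  have "expected_tail_length (2 * m) =
      (\<Sum>k<2 * m. real k * (real k + 1) / 2 * rho_weight m k) / (2 * real m * rho_weight m 0)"
    unfolding expected_tail_length_def
    using expectation_binary_functional_maps[OF assms, of "\<lambda>t c. real t"]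
    by (simp only: gauss_sum_real mult_zero_left add_0 of_nat_0)
  also have "(\<Sum>k<2 * m. real k * (real k + 1) / 2 * rho_weight m k) =
      (\<Sum>k\<le>m. real k * (real k + 1) * rho_weight m k) / 2"
    unfolding sum_rho_weight_extend[OF assms] by (simp add: sum_divide_distrib)
  finally show ?thesis
    unfolding sum_mult_Suc_rho_weight[OF assms] using assms
    by (simp add: rho_weight_0 field_simps)
qed

text \<open>On each diagonal, tails and cycles of the noncyclic starting nodes both run through
  \<open>1..k\<close>, in opposite order. The difference of the expectations therefore comes from
  the cyclic starting nodes alone.\<close>

lemma expected_cycle_length_even:
  assumes "m > 0"
  shows "expected_cycle_length (2 * m) = expected_tail_length (2 * m) +
    (2 * real m + 1 - 4 ^ m / real ((2 * m) choose m)) / (2 * real m)"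
proof -
  let ?d = "2 * real m * rho_weight m 0"
  have "(\<Sum>k<2 * m. real (Suc k) * rho_weight m (Suc k)) = (\<Sum>k<Suc (2 * m). real k * rho_weight m k)"
    by (simp only: sum.lessThan_Suc_shift mult_zero_left of_nat_0 add_0)
  \<comment> \<open>Writing \<open>k\<close> as \<open>(k + 1) - 1\<close> reduces the sum to the
    first moment and the total weight.\<close>
  also have "\<dots> = (\<Sum>k\<le>m. (real k + 1) * rho_weight m k - rho_weight m k)"
    using sum_rho_weight_extend[OF assms, of real] rho_weight_eq_0[OF assms, of "2 * m"] assms
    by (simp add: distrib_right)
  also have "\<dots> = (2 * real m + 1) * rho_weight m 0 - 4 ^ m"
    by (simp only: sum_subtractf sum_Suc_rho_weight[OF assms] sum_rho_weight)
  finally have cyclic: "(\<Sum>k<2 * m. real (Suc k) * rho_weight m (Suc k)) =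
      (2 * real m + 1) * rho_weight m 0 - 4 ^ m" .
  have "expected_cycle_length (2 * m) =
      (\<Sum>k<2 * m. real (Suc k) * rho_weight m (Suc k) + real k * (real k + 1) / 2 * rho_weight m k) / ?d"
    unfolding expected_cycle_length_def
    using expectation_binary_functional_maps[OF assms, of "\<lambda>t c. real c"]
    by (simp only: sum_Suc_diff_real)
  also have "\<dots> = (\<Sum>k<2 * m. real k * (real k + 1) / 2 * rho_weight m k) / ?d
      + (\<Sum>k<2 * m. real (Suc k) * rho_weight m (Suc k)) / ?d"
    by (simp only: sum.distrib add_divide_distrib add.commute)
  also have "(\<Sum>k<2 * m. real k * (real k + 1) / 2 * rho_weight m k) / ?d = expected_tail_length (2 * m)"
    unfolding expected_tail_length_def
    using expectation_binary_functional_maps[OF assms, of "\<lambda>t c. real t"]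
    by (simp only: gauss_sum_real mult_zero_left add_0 of_nat_0)
  finally show ?thesis
    unfolding cyclic using assms by (simp add: rho_weight_0 field_simps)
qed

subsection \<open>Asymptotics\<close>

text \<open>Passing from \<open>m\<close> to \<open>m + 1\<close> multiplies
  \<open>4 ^ m / ((2 * m) choose m)\<close> by \<open>2 * (m + 1) / (2 * m + 1)\<close>. The left
  side thus gains the factor \<open>4 * (m + 1)^2 / ((2 * m + 1) * (2 * m + 3))\<close>, which is
  the next Wallis factor.\<close>

lemma central_binomial_Wallis:
  "(4 ^ m / real ((2 * m) choose m))\<^sup>2 / (2 * real m + 1) = (\<Prod>k=1..m. (4 * real k ^ 2) / (4 * real k ^ 2 - 1))"
proof (induction m)
  case (Suc m)
  have "Suc m * (2 * Suc m choose Suc m) = 2 * Suc m * (Suc (2 * m) choose m)"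
    using Suc_times_binomial_eq[of "Suc (2 * m)" m] by (simp add: mult.commute)
  moreover have "Suc m * (Suc (2 * m) choose m) = Suc (2 * m) * (2 * m choose m)"
    using binomial_absorb_comp[of "Suc (2 * m)" m] by (simp add: mult.commute)
  ultimately have "Suc m * (2 * Suc m choose Suc m) = 2 * Suc (2 * m) * (2 * m choose m)"
    by (simp add: algebra_simps)
  then have "real (Suc m) * real (2 * Suc m choose Suc m) = 2 * (2 * real m + 1) * real (2 * m choose m)"
    by (metis (no_types, opaque_lifting) of_nat_Suc of_nat_mult of_nat_numeral add.commute)
  then have rec: "real (2 * Suc m choose Suc m) = 2 * (2 * real m + 1) / real (Suc m) * real (2 * m choose m)"
    by (simp add: field_simps)
  have "4 * a / (2 * d / e * C) = a / C * (2 * e / d)" for a d e C :: real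
    by (simp add: divide_simps)
  then have "4 ^ Suc m / real (2 * Suc m choose Suc m) =
      4 ^ m / real (2 * m choose m) * (2 * real (Suc m) / (2 * real m + 1))"
    unfolding rec power_Suc .
  moreover have "(2 * real (Suc m) / (2 * real m + 1))\<^sup>2 / (2 * real (Suc m) + 1) =
      1 / (2 * real m + 1) * (4 * real (Suc m) ^ 2 / (4 * real (Suc m) ^ 2 - 1))"
  proof -
    have "4 * real (Suc m) ^ 2 - 1 = (2 * real m + 1) * (2 * real (Suc m) + 1)"
      by (simp add: algebra_simps power2_eq_square)
    moreover have "(2 * e / d)\<^sup>2 / f = 1 / d * (4 * e\<^sup>2 / (d * f))" for d e f :: real
      by (simp add: power2_eq_square)
    ultimately show ?thesis by (simp only:)
  qed
  ultimately have "(4 ^ Suc m / real (2 * Suc m choose Suc m))\<^sup>2 / (2 * real (Suc m) + 1) =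
      (4 ^ m / real (2 * m choose m))\<^sup>2 / (2 * real m + 1) *
      (4 * real (Suc m) ^ 2 / (4 * real (Suc m) ^ 2 - 1))"
    by (simp only: power_mult_distrib times_divide_eq_right[symmetric] mult_1_right mult.assoc)
      (simp only: times_divide_eq_right mult_1_right times_divide_eq_left mult_1_left)
  then show ?case unfolding Suc by simp
qed simp

text \<open>The quotient is the square root of the Wallis product times the square root of
  \<open>(2 * m + 1) / (pi * m)\<close>; their limits \<open>sqrt (pi / 2)\<close> and
  \<open>sqrt (2 / pi)\<close> are reciprocal.\<close>

lemma central_binomial_asymp:
  "(\<lambda>m. 4 ^ m / real ((2 * m) choose m) / sqrt (pi * real m)) \<longlonglongrightarrow> 1"
proof -
  let ?B = "\<lambda>m. 4 ^ m / real ((2 * m) choose m)"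
  have "(\<lambda>m. sqrt ((?B m)\<^sup>2 / (2 * real m + 1)) * sqrt ((2 * real m + 1) / (pi * real m)))
      \<longlonglongrightarrow> sqrt (pi / 2) * sqrt (2 / pi)"
  proof (intro tendsto_mult tendsto_real_sqrt)
    show "(\<lambda>m. (?B m)\<^sup>2 / (2 * real m + 1)) \<longlonglongrightarrow> pi / 2"
      unfolding central_binomial_Wallis by (rule wallis)
    show "(\<lambda>m. (2 * real m + 1) / (pi * real m)) \<longlonglongrightarrow> 2 / pi"
    proof -
      have "(\<lambda>m. (2 * real m + 1) / (pi * real m)) \<longlonglongrightarrow> 2 * inverse pi"
        by real_asymp
      then show ?thesis by (simp add: divide_inverse)
    qed
  qed
  moreover have "sqrt (pi / 2) * sqrt (2 / pi) = 1"
    by (simp flip: real_sqrt_mult)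
  moreover have "sqrt ((?B m)\<^sup>2 / (2 * real m + 1)) * sqrt ((2 * real m + 1) / (pi * real m)) =
      ?B m / sqrt (pi * real m)" for m
  proof -
    have "sqrt (b\<^sup>2 / y) * sqrt (y / x) = b / sqrt x" if "b \<ge> 0" "y > 0" for b x y :: real
      using that by (simp add: real_sqrt_divide)
    then show ?thesis by simp
  qed
  ultimately show ?thesis by simp
qed

text \<open>\<open>even_at_top\<close> is at least as fine as the image of \<open>at_top\<close>
  under doubling, so limits along \<open>2 * m\<close> carry over.\<close>

lemma asymp_equiv_even_at_top:
  fixes f g :: "nat \<Rightarrow> real"
  assumes "(\<lambda>m. f (2 * m)) \<sim>[at_top] (\<lambda>m. g (2 * m))"
  shows "f \<sim>[even_at_top] g"
proof -
  have "even_at_top \<le> filtermap (\<lambda>m. 2 * m) at_top"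
  proof (rule filter_leI)
    fix P assume "eventually P (filtermap (\<lambda>m::nat. 2 * m) at_top)"
    then obtain N where N: "\<And>m. m \<ge> N \<Longrightarrow> P (2 * m)"
      by (auto simp: eventually_filtermap eventually_at_top_linorder)
    have "P n" if "n \<ge> 2 * N" "even n" for n
      using N[of "n div 2"] that by auto
    then show "eventually P even_at_top"
      unfolding even_at_top_def eventually_inf_principal eventually_at_top_linorder by auto
  qed
  moreover have "f \<sim>[filtermap (\<lambda>m. 2 * m) at_top] g"
    using assms by (simp add: asymp_equiv_filtermap_iff)
  ultimately show ?thesis
    by (auto simp: asymp_equiv_def intro: tendsto_mono)
qed

theorem theorem6:
  shows "expected_cycle_length \<sim>[even_at_top] (\<lambda>n. sqrt (pi * real n / 8)) \<and>
         expected_tail_length \<sim>[even_at_top] (\<lambda>n. sqrt (pi * real n / 8))"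
proof -
  let ?B = "\<lambda>m. 4 ^ m / real ((2 * m) choose m)"
  let ?b = "\<lambda>m. ?B m / sqrt (pi * real m)"
  have root: "sqrt (pi * real (2 * m) / 8) = sqrt (pi * real m) / 2" for m
  proof -
    have "pi * real (2 * m) / 8 = pi * real m / 4" by simp
    then show ?thesis by (simp only: real_sqrt_divide) simp
  qed
  \<comment> \<open>Here \<open>x\<close> stands for \<open>m\<close>, \<open>y\<close> for
    \<open>2 * m + 1\<close> and \<open>s\<close> for \<open>sqrt (pi * m)\<close>. The split
    isolates \<open>B / s\<close>, which tends to 1, from a term of order
    \<open>1 / sqrt m\<close>.\<close>
  have "((x + 1) * B - y) / (2 * x) / (s / 2) = B / s * ((x + 1) / x) - y / (x * s)"
    for B s x y :: real
    by (simp add: divide_simps)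
  then have tail_eq: "expected_tail_length (2 * m) / sqrt (pi * real (2 * m) / 8) =
      ?b m * ((real m + 1) / real m) - (2 * real m + 1) / (real m * sqrt (pi * real m))"
    if "m > 0" for m
    unfolding root expected_tail_length_even[OF that] .
  have "(T + (y - B) / (2 * x)) / (s / 2) = T / (s / 2) + (y / (x * s) - B / s * (1 / x))"
    for B T s x y :: real
    by (simp add: divide_simps)
  then have cycle_eq: "expected_cycle_length (2 * m) / sqrt (pi * real (2 * m) / 8) =
      expected_tail_length (2 * m) / sqrt (pi * real (2 * m) / 8)
      + ((2 * real m + 1) / (real m * sqrt (pi * real m)) - ?b m * (1 / real m))"
    if "m > 0" for m
    unfolding root expected_cycle_length_even[OF that] .
  have small: "(\<lambda>m. (2 * real m + 1) / (real m * sqrt (pi * real m))) \<longlonglongrightarrow> 0"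
    by real_asymp
  have "(\<lambda>m. ?b m * ((real m + 1) / real m) - (2 * real m + 1) / (real m * sqrt (pi * real m)))
      \<longlonglongrightarrow> 1 * 1 - 0"
    by (intro tendsto_diff tendsto_mult central_binomial_asymp small) real_asymp
  then have tail: "(\<lambda>m. expected_tail_length (2 * m) / sqrt (pi * real (2 * m) / 8)) \<longlonglongrightarrow> 1"
    \<comment> \<open>The closed form is available for \<open>m > 0\<close>, hence
      eventually.\<close>
    by (subst tendsto_cong[OF eventually_mono[OF eventually_gt_at_top[of 0] tail_eq]]) simp_all
  \<comment> \<open>The gap between the two expectations vanishes after division by the square root,
    so the limit 1 carries over from the tail.\<close>
  have "(\<lambda>m. expected_tail_length (2 * m) / sqrt (pi * real (2 * m) / 8)
      + ((2 * real m + 1) / (real m * sqrt (pi * real m)) - ?b m * (1 / real m))) \<longlonglongrightarrow> 1 + (0 - 1 * 0)"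
    by (intro tendsto_add tendsto_diff tendsto_mult central_binomial_asymp small tail) real_asymp
  then have cycle: "(\<lambda>m. expected_cycle_length (2 * m) / sqrt (pi * real (2 * m) / 8)) \<longlonglongrightarrow> 1"
    by (subst tendsto_cong[OF eventually_mono[OF eventually_gt_at_top[of 0] cycle_eq]]) simp_all
  show ?thesis
    by (intro conjI asymp_equiv_even_at_top asymp_equivI' tail cycle)
qed

end
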